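(* Define $\mathcal{I}(x,\theta)=\|\nabla^2_\theta J(\theta)\|_2$ and $\tilde{\mathcal{I}}(x,\theta)=\|\nabla^2_\theta J_{\mathrm{ALP}}(\theta,\sigma)\|_2$, where $J(\theta)$ is the non-perturbed surrogate objective at input $x$ and $J_{\mathrm{ALP}}(\theta,\sigma)$ is the perturbed surrogate objective at input $x$ (both given in the context, with their dependence on $x$ suppressed in the notation). If there exists a smallest constant $0<c<1$ such that $$\int \mathbf{1}\left(\mathcal{I}(x,\theta)\ge \tfrac{c}{2}\cdot\max_{x}\mathcal{I}(x,\theta)\right)dx<+\infty,$$ then with some proper distribution $\delta\sim\mathcal{N}(0,\sigma^2 I)$ (that is, for a suitable choice of $\sigma$), we have $$\sup_x\tilde{\mathcal{I}}(x,\theta)\le c\cdot\sup_x\mathcal{I}(x,\theta).$$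
   Context: Setting: reinforcement learning of a language-model policy, analyzed for a perturbation of a single layer. The input (prompt representation) is a vector $x$, and $a$ is an action (response). $\pi_\theta(a\mid x)$ is the training policy with parameter $\theta$. $\pi^{\mathrm{infer}}_{\theta_{\mathrm{old}}}(a\mid x)$ is the rollout (inference) policy, built from the previous parameter $\theta_{\mathrm{old}}$. $\hat A(a)$ is the advantage of action $a$. The Gaussian perturbation $\delta\sim\mathcal{N}(0,\sigma^2 I)$ is added to the input of the training policy only, never to the inference policy. The objectives at input $x$ are $$J(\theta)=\mathbb{E}_{a\sim\pi^{\mathrm{infer}}_{\theta_{\mathrm{old}}}(\cdot\mid x)}\left[\frac{\pi_\theta(a\mid x)}{\pi^{\mathrm{infer}}_{\theta_{\mathrm{old}}}(a\mid x)}\cdot\hat A(a)\right],\qquad J_{\mathrm{ALP}}(\theta,\sigma)=\mathbb{E}_{\delta}\,\mathbb{E}_{a\sim\pi^{\mathrm{infer}}_{\theta_{\mathrm{old}}}(\cdot\mid x)}\left[\frac{\pi_\theta(a\mid x+\delta)}{\pi^{\mathrm{infer}}_{\theta_{\mathrm{old}}}(a\mid x)}\cdot\hat A(a)\right].$$ Here $\nabla^2_\theta$ is the Hessian in $\theta$, $\|\cdot\|_2$ is the spectral norm, $\mathbf{1}(\cdot)$ is the indicator function, and $dx$ is Lebesgue measure on the input space.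
   Formalization: Adds, for parameters near θ: J is twice differentiable; its Hessian norm is at most some g(x) with finite Gaussian means; J_ALP exists for all σ; the rollout policy at every input gives positive probability to each action the training policy can take at any input. The claim fails without these. *)

theory Defs
  imports "HOL-Probability.Probability"
begin

definition partial_deriv :: "'p::finite \<Rightarrow> (real^'p \<Rightarrow> real) \<Rightarrow> real^'p \<Rightarrow> real" where
  "partial_deriv i f \<theta> = deriv (\<lambda>t. f (\<theta> + t *\<^sub>R axis i 1)) 0"

definition hessian :: "(real^'p \<Rightarrow> real) \<Rightarrow> real^'p \<Rightarrow> real^'p^('p::finite)" where
  "hessian f \<theta> = (\<chi> i j. partial_deriv i (partial_deriv j f) \<theta>)"

definition twice_differentiable_on :: "(real^('p::finite) \<Rightarrow> real) \<Rightarrow> (real^'p) set \<Rightarrow> bool" where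
  "twice_differentiable_on f U \<longleftrightarrow>
     f differentiable_on U \<and> (\<forall>j. partial_deriv j f differentiable_on U)"

definition spectral_norm :: "real^'n^'m \<Rightarrow> real" where
  "spectral_norm H = onorm (\<lambda>v. H *v v)"

definition gaussian :: "real \<Rightarrow> 'x::euclidean_space measure" where
  "gaussian \<sigma> = density lborel (\<lambda>\<delta>. ennreal (\<Prod>b\<in>Basis. normal_density 0 \<sigma> (\<delta> \<bullet> b)))"

text \<open>
  \<open>\<pi> \<theta> x\<close> is the training policy and \<open>\<mu> \<theta>\<^sub>o x\<close> the rollout policy. The set of responses is discrete,
  so both are probability mass functions. The integrand below has two input arguments because the
  perturbed objective moves the input of the training policy (\<open>y\<close>) but not that of the rollout
  policy (\<open>x\<close>).
\<close>

definition weighted_advantage ::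
  "('p \<Rightarrow> 'x \<Rightarrow> 'a pmf) \<Rightarrow> ('p \<Rightarrow> 'x \<Rightarrow> 'a pmf) \<Rightarrow> ('a \<Rightarrow> real) \<Rightarrow> 'p \<Rightarrow> 'x \<Rightarrow> 'x \<Rightarrow> 'p \<Rightarrow> 'a \<Rightarrow> real" where
  "weighted_advantage \<pi> \<mu> A \<theta>\<^sub>o x y \<theta> a = pmf (\<pi> \<theta> y) a / pmf (\<mu> \<theta>\<^sub>o x) a * A a"

definition J ::
  "('p \<Rightarrow> 'x \<Rightarrow> 'a pmf) \<Rightarrow> ('p \<Rightarrow> 'x \<Rightarrow> 'a pmf) \<Rightarrow> ('a \<Rightarrow> real) \<Rightarrow> 'p \<Rightarrow> 'x \<Rightarrow> 'p \<Rightarrow> real" where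
  "J \<pi> \<mu> A \<theta>\<^sub>o x \<theta> =
     measure_pmf.expectation (\<mu> \<theta>\<^sub>o x) (weighted_advantage \<pi> \<mu> A \<theta>\<^sub>o x x \<theta>)"

definition J_ALP ::
  "('p \<Rightarrow> 'x::euclidean_space \<Rightarrow> 'a pmf) \<Rightarrow> ('p \<Rightarrow> 'x \<Rightarrow> 'a pmf) \<Rightarrow> ('a \<Rightarrow> real) \<Rightarrow> 'p \<Rightarrow> real \<Rightarrow> 'x \<Rightarrow> 'p \<Rightarrow> real" where
  "J_ALP \<pi> \<mu> A \<theta>\<^sub>o \<sigma> x \<theta> =
     (\<integral>\<delta>. measure_pmf.expectation (\<mu> \<theta>\<^sub>o x) (weighted_advantage \<pi> \<mu> A \<theta>\<^sub>o x (x + \<delta>) \<theta>) \<partial>gaussian \<sigma>)"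

definition curvature ::
  "(real^'p \<Rightarrow> 'x \<Rightarrow> 'a pmf) \<Rightarrow> (real^'p \<Rightarrow> 'x \<Rightarrow> 'a pmf) \<Rightarrow> ('a \<Rightarrow> real) \<Rightarrow> real^'p \<Rightarrow> 'x \<Rightarrow> real^('p::finite) \<Rightarrow> real" where
  "curvature \<pi> \<mu> A \<theta>\<^sub>o x \<theta> = spectral_norm (hessian (J \<pi> \<mu> A \<theta>\<^sub>o x) \<theta>)"

definition curvature_ALP ::
  "(real^'p \<Rightarrow> 'x::euclidean_space \<Rightarrow> 'a pmf) \<Rightarrow> (real^'p \<Rightarrow> 'x \<Rightarrow> 'a pmf) \<Rightarrow> ('a \<Rightarrow> real) \<Rightarrow> real^'p \<Rightarrow> real
     \<Rightarrow> 'x \<Rightarrow> real^('p::finite) \<Rightarrow> real" where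
  "curvature_ALP \<pi> \<mu> A \<theta>\<^sub>o \<sigma> x \<theta> = spectral_norm (hessian (J_ALP \<pi> \<mu> A \<theta>\<^sub>o \<sigma> x) \<theta>)"

text \<open>
  The supremum is taken in the extended reals: it agrees with the maximum over \<open>x\<close> when that is
  attained and needs no boundedness side condition otherwise.
\<close>

definition finite_high_curvature ::
  "('x::euclidean_space \<Rightarrow> real) \<Rightarrow> real \<Rightarrow> bool" where
  "finite_high_curvature I c \<longleftrightarrow>
     (\<integral>\<^sup>+ x. indicator {x. ereal (I x) \<ge> ereal (c / 2) * (SUP z. ereal (I z))} x \<partial>lborel) < \<infinity>"

end

theory Submission
  imports Defs
begin

text \<open>
  The importance ratio cancels the rollout policy, so the perturbed objective at \<open>x\<close> is the Gaussian
  average of the unperturbed objective over the inputs \<open>x + \<delta>\<close>. Differentiating twice under the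
  integral bounds the perturbed curvature by the Gaussian average of the curvature \<open>I\<close>. With
  \<open>m = sup I\<close>, the inputs where \<open>I < c m / 2\<close> contribute at most \<open>c m / 2\<close> to this average. The others
  form a set of finite Lebesgue measure \<open>s\<close>, whose Gaussian mass is at most \<open>s / \<sigma>\<close> for \<open>\<sigma> \<ge> 1\<close>
  uniformly in \<open>x\<close>, and \<open>\<sigma> = max 1 (2 s / c)\<close> makes their contribution at most \<open>c m / 2\<close> too.
\<close>

section \<open>Differentiation under the integral sign\<close>

text \<open>Dominated convergence for the difference quotients at 0, which the bound keeps below
  \<open>w\<close>. Derivative and Lipschitz bound are required only at the base point 0, so the
  lemma also serves for the last order of differentiation, where nothing is known about a further
  derivative.\<close>

lemma
  fixes f :: "real \<Rightarrow> 'b \<Rightarrow> real" and f' w :: "'b \<Rightarrow> real"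
  assumes r: "r > 0"
    and int: "\<And>t. \<bar>t\<bar> < r \<Longrightarrow> integrable M (f t)"
    and deriv: "\<And>x. x \<in> space M \<Longrightarrow> ((\<lambda>t. f t x) has_real_derivative f' x) (at 0)"
    and bound: "\<And>t x. \<bar>t\<bar> < r \<Longrightarrow> x \<in> space M \<Longrightarrow> \<bar>f t x - f 0 x\<bar> \<le> w x * \<bar>t\<bar>"
    and w: "integrable M w"
  shows integrable_deriv_dominated: "integrable M f'"
    and has_real_derivative_integral_dominated:
      "((\<lambda>t. \<integral>x. f t x \<partial>M) has_real_derivative (\<integral>x. f' x \<partial>M)) (at 0)"
proof -
  let ?S = "{-r<..<r}"
  have at0: "at 0 = at (0::real) within ?S"
    using r by (intro at_within_open[symmetric]) auto
  \<comment> \<open>The limit at 0 is tested along sequences, because dominated convergence is a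
    statement about sequences. The same application yields integrability of the limit.\<close>
  have *: "integrable M f' \<and>
      (\<lambda>n. ((\<integral>x. f (X n) x \<partial>M) - (\<integral>x. f 0 x \<partial>M)) / X n) \<longlonglongrightarrow> (\<integral>x. f' x \<partial>M)"
    if X: "\<forall>n. X n \<in> ?S - {0}" "X \<longlonglongrightarrow> 0" for X
  proof -
    let ?q = "\<lambda>n x. (f (X n) x - f 0 x) / X n"
    have Xr: "\<bar>X n\<bar> < r" and X0: "X n \<noteq> 0" for n
      using X(1)[rule_format, of n] by (auto simp: abs_if)
    have int_q: "integrable M (?q n)" for n
      using int[OF Xr[of n]] int[of 0] r by simp
    have lim: "(\<lambda>n. ?q n x) \<longlonglongrightarrow> f' x" if "x \<in> space M" for x
    proof -
      have "((\<lambda>h. (f (0 + h) x - f 0 x) / h) \<longlongrightarrow> f' x) (at 0 within ?S)"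
        using deriv[OF that] unfolding DERIV_def at0[symmetric] .
      then show ?thesis
        using X unfolding tendsto_at_iff_sequentially by (simp add: o_def)
    qed
    have dom: "AE x in M. norm (?q n x) \<le> w x" for n
    proof (rule AE_I2)
      fix x assume "x \<in> space M"
      from bound[OF Xr[of n] this] X0[of n] show "norm (?q n x) \<le> w x"
        by (simp add: abs_divide divide_le_eq)
    qed
    have lim': "AE x in M. (\<lambda>n. ?q n x) \<longlonglongrightarrow> f' x"
      using lim by (rule AE_I2)
    have mq: "\<And>n. ?q n \<in> borel_measurable M"
      using int_q by (rule borel_measurable_integrable)
    \<comment> \<open>Measurability of \<open>f'\<close> is not assumed; it is inherited from the
      quotients as their pointwise limit.\<close>
    have meas: "f' \<in> borel_measurable M"
      by (rule borel_measurable_LIMSEQ_real[OF lim mq])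
    have eq: "(\<integral>x. ?q n x \<partial>M) = ((\<integral>x. f (X n) x \<partial>M) - (\<integral>x. f 0 x \<partial>M)) / X n" for n
      using int[OF Xr[of n]] int[of 0] r by simp
    show ?thesis
      using integral_dominated_convergence[OF meas mq w lim' dom]
        integrable_dominated_convergence[OF meas mq w lim' dom]
      unfolding eq by blast
  qed
  \<comment> \<open>Integrability of \<open>f'\<close> is a by-product of \<open>*\<close>, so one
    admissible sequence has to be exhibited. The factor \<open>r / 2\<close> keeps it strictly
    inside the interval.\<close>
  define X where "X n = r / 2 * inverse (real (Suc n))" for n
  have XS: "\<forall>n. X n \<in> ?S - {0}"
  proof
    fix n
    have "r * inverse (real (Suc n)) \<le> r * 1"
      using r by (intro mult_left_mono) (auto simp: inverse_le_1_iff)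
    then have "X n \<le> r / 2" by (simp add: X_def)
    moreover have "X n > 0" using r by (simp add: X_def)
    ultimately show "X n \<in> ?S - {0}" using r by auto
  qed
  have "X \<longlonglongrightarrow> 0"
    unfolding X_def by (rule tendsto_mult_right_zero[OF LIMSEQ_inverse_real_of_nat])
  from *[OF XS this] show "integrable M f'" ..
  show "((\<lambda>t. \<integral>x. f t x \<partial>M) has_real_derivative (\<integral>x. f' x \<partial>M)) (at 0)"
    unfolding DERIV_def unfolding at0 tendsto_at_iff_sequentially
  proof (intro allI impI)
    fix X :: "nat \<Rightarrow> real"
    assume "\<forall>n. X n \<in> ?S - {0}" "X \<longlonglongrightarrow> 0"
    from *[OF this] show "((\<lambda>h. ((\<integral>x. f (0 + h) x \<partial>M) - (\<integral>x. f 0 x \<partial>M)) / h) \<circ> X)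
        \<longlonglongrightarrow> (\<integral>x. f' x \<partial>M)"
      by (simp add: o_def)
  qed
qed

text \<open>
  No bound on the first derivative is assumed: at \<open>0\<close> it differs from the integrable difference
  quotient of step \<open>r / 2\<close> by at most \<open>r * w x\<close>.
\<close>

lemma
  fixes f f1 f2 :: "real \<Rightarrow> 'b \<Rightarrow> real" and w :: "'b \<Rightarrow> real"
  assumes r: "r > 0"
    and int: "\<And>t. \<bar>t\<bar> < r \<Longrightarrow> integrable M (f t)"
    and d1: "\<And>t x. \<bar>t\<bar> < r \<Longrightarrow> x \<in> space M \<Longrightarrow> ((\<lambda>t. f t x) has_real_derivative f1 t x) (at t)"
    and d2: "\<And>t x. \<bar>t\<bar> < r \<Longrightarrow> x \<in> space M \<Longrightarrow> ((\<lambda>t. f1 t x) has_real_derivative f2 t x) (at t)"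
    and bound: "\<And>t x. \<bar>t\<bar> < r \<Longrightarrow> x \<in> space M \<Longrightarrow> \<bar>f2 t x\<bar> \<le> w x"
    and w: "integrable M w"
  shows integrable_deriv_second_bounded: "integrable M (f1 0)"
    and has_real_derivative_integral_second_bounded:
      "((\<lambda>t. \<integral>x. f t x \<partial>M) has_real_derivative (\<integral>x. f1 0 x \<partial>M)) (at 0)"
proof -
  \<comment> \<open>One \<open>r * w x\<close> pays for replacing \<open>f1 0 x\<close> by the
    difference quotient of step \<open>r / 2\<close>, the other for the variation of
    \<open>f1\<close> over the interval. Hence \<open>W\<close> dominates \<open>f1\<close> on the
    whole interval.\<close>
  define W where "W x = 2 / r * \<bar>f (r / 2) x - f 0 x\<bar> + 2 * (r * w x)" for x
  have W: "integrable M W"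
    unfolding W_def using int[of "r/2"] int[of 0] r w by simp
  have bnd: "\<bar>f t x - f 0 x\<bar> \<le> W x * \<bar>t\<bar>" if t: "\<bar>t\<bar> < r" and x: "x \<in> space M" for t x
  proof -
    let ?S = "{-r<..<r}"
    have S: "\<bar>s\<bar> < r" if "s \<in> ?S" for s using that by auto
    have w0: "0 \<le> w x" using bound[of 0 x] r x by auto
    have f1: "\<bar>f1 s x - f1 0 x\<bar> \<le> r * w x" if s: "s \<in> ?S" for s
    proof -
      have "norm (f1 s x - f1 0 x) \<le> w x * norm (s - 0)"
        using s r by (intro field_differentiable_bound[where S = ?S and f' = "\<lambda>t. f2 t x"])
          (auto intro!: has_field_derivative_at_within[OF d2] bound x S)
      also have "\<dots> \<le> w x * r" using S[OF s] w0 by (intro mult_left_mono) auto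
      finally show ?thesis by (simp add: mult.commute)
    qed
    \<comment> \<open>Mean value inequality for \<open>f t x - t * f1 0 x\<close>, whose derivative
      \<open>f1 t x - f1 0 x\<close> is at most \<open>r * w x\<close> in absolute value.\<close>
    have "norm ((f (r/2) x - r/2 * f1 0 x) - (f 0 x - 0 * f1 0 x)) \<le> r * w x * norm (r/2 - 0)"
      using r by (intro field_differentiable_bound[where S = ?S and f' = "\<lambda>t. f1 t x - f1 0 x"])
        (auto intro!: derivative_eq_intros has_field_derivative_at_within[OF d1] f1 x S)
    then have "\<bar>(f (r/2) x - f 0 x) - r/2 * f1 0 x\<bar> \<le> r * w x * (r/2)"
      using r by (simp add: algebra_simps)
    then have "\<bar>r/2 * f1 0 x\<bar> \<le> \<bar>f (r/2) x - f 0 x\<bar> + r * w x * (r/2)"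
      by linarith
    then have "2 / r * (r/2 * \<bar>f1 0 x\<bar>) \<le> 2 / r * (\<bar>f (r/2) x - f 0 x\<bar> + r * w x * (r/2))"
      using r by (intro mult_left_mono) (auto simp: abs_mult)
    then have f10: "\<bar>f1 0 x\<bar> \<le> W x - r * w x"
      using r by (simp add: W_def field_simps)
    have f1W: "\<bar>f1 s x\<bar> \<le> W x" if "s \<in> ?S" for s
      using f1[OF that] f10 by linarith
    have "norm (f t x - f 0 x) \<le> W x * norm (t - 0)"
      using r t by (intro field_differentiable_bound[where S = ?S and f' = "\<lambda>t. f1 t x"])
        (auto intro!: has_field_derivative_at_within[OF d1] f1W x S)
    then show ?thesis by simp
  qed
  have d0: "((\<lambda>t. f t x) has_real_derivative f1 0 x) (at 0)" if "x \<in> space M" for x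
    using d1[of 0 x] r that by simp
  show "integrable M (f1 0)"
    by (rule integrable_deriv_dominated[OF r int d0 bnd W])
  show "((\<lambda>t. \<integral>x. f t x \<partial>M) has_real_derivative (\<integral>x. f1 0 x \<partial>M)) (at 0)"
    by (rule has_real_derivative_integral_dominated[OF r int d0 bnd W])
qed

section \<open>Vector-valued integrals and the spectral norm\<close>

text \<open>A vector is the finite sum of its embedded components. The components may themselves be
  vectors, so that matrices are handled by two applications, first to rows and then to
  entries.\<close>

lemma
  fixes f :: "'b \<Rightarrow> ('c::euclidean_space)^'n"
  assumes int: "\<And>i. integrable M (\<lambda>x. f x $ i)"
  shows integrable_vecI: "integrable M f"
    and integral_vec_nth: "(\<integral>x. f x \<partial>M) $ i = (\<integral>x. f x $ i \<partial>M)"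
proof -
  have axis_lin: "bounded_linear (axis k :: 'c \<Rightarrow> 'c^'n)" for k
    by (intro linear_conv_bounded_linear[THEN iffD1] linearI) (auto simp: axis_def vec_eq_iff)
  have "f = (\<lambda>x. \<Sum>k\<in>UNIV. axis k (f x $ k))"
    by (auto simp: fun_eq_iff vec_eq_iff axis_def if_distrib cong: if_cong)
  moreover have "integrable M (\<lambda>x. \<Sum>k\<in>UNIV. axis k (f x $ k))"
    by (intro Bochner_Integration.integrable_sum integrable_bounded_linear[OF axis_lin] int)
  ultimately show *: "integrable M f" by simp
  show "(\<integral>x. f x \<partial>M) $ i = (\<integral>x. f x $ i \<partial>M)"
    using integral_bounded_linear[OF bounded_linear_vec_nth *] by simp
qed

lemma spectral_norm_nonneg: "0 \<le> spectral_norm (H :: real^'n^'m)"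
  unfolding spectral_norm_def by (rule onorm_pos_le) simp

text \<open>Subadditivity and positive homogeneity make the norm convex, and a real-valued convex
  function on a finite-dimensional space is continuous.\<close>

lemma borel_measurable_spectral_norm [measurable]:
  "(spectral_norm :: real^'n^'m \<Rightarrow> real) \<in> borel_measurable borel"
proof -
  have "spectral_norm (u *\<^sub>R A + v *\<^sub>R B) \<le> u * spectral_norm A + v * spectral_norm B"
    if "0 \<le> u" "0 \<le> v" for u v and A B :: "real^'n^'m"
  proof -
    have "spectral_norm (u *\<^sub>R A + v *\<^sub>R B) = onorm (\<lambda>x. u *\<^sub>R (A *v x) + v *\<^sub>R (B *v x))"
      by (simp add: spectral_norm_def matrix_vector_mult_add_rdistrib scaleR_matrix_vector_assoc)
    also have "\<dots> \<le> onorm (\<lambda>x. u *\<^sub>R (A *v x)) + onorm (\<lambda>x. v *\<^sub>R (B *v x))"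
      by (intro onorm_triangle bounded_linear_scaleR_right[THEN bounded_linear_compose]) auto
    also have "\<dots> = u * spectral_norm A + v * spectral_norm B"
      using that by (simp add: onorm_scaleR spectral_norm_def)
    finally show ?thesis .
  qed
  then have "convex_on UNIV (spectral_norm :: real^'n^'m \<Rightarrow> real)"
    by (intro convex_onI) auto
  then show ?thesis
    by (intro borel_measurable_continuous_onI convex_on_continuous) auto
qed

text \<open>Applying a matrix to a fixed vector \<open>v\<close> is linear and commutes with the
  integral, so the triangle inequality for vector integrals gives the bound for every
  \<open>v\<close>.\<close>

lemma spectral_norm_integral_le:
  fixes H :: "'b \<Rightarrow> real^'n^'m"
  assumes H: "integrable M H" and N: "integrable M (\<lambda>x. spectral_norm (H x))"
  shows "spectral_norm (\<integral>x. H x \<partial>M) \<le> (\<integral>x. spectral_norm (H x) \<partial>M)"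
  unfolding spectral_norm_def
proof (rule onorm_le)
  fix v :: "real^'n"
  have lin: "bounded_linear (\<lambda>A :: real^'n^'m. A *v v)"
    by (intro linear_conv_bounded_linear[THEN iffD1] linearI)
      (auto simp: matrix_vector_mult_add_rdistrib scaleR_matrix_vector_assoc)
  have int: "integrable M (\<lambda>x. H x *v v)"
    by (rule integrable_bounded_linear[OF lin H])
  have "norm ((\<integral>x. H x \<partial>M) *v v) = norm (\<integral>x. H x *v v \<partial>M)"
    by (simp add: integral_bounded_linear[OF lin H])
  also have "\<dots> \<le> (\<integral>x. norm (H x *v v) \<partial>M)" by simp
  also have "\<dots> \<le> (\<integral>x. spectral_norm (H x) * norm v \<partial>M)"
    using int N by (intro integral_mono) (auto simp: spectral_norm_def intro!: onorm)
  finally show "norm ((\<integral>x. H x \<partial>M) *v v) \<le> (\<integral>x. onorm ((*v) (H x)) \<partial>M) * norm v"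
    by (simp add: spectral_norm_def)
qed

section \<open>The Hessian of an integral\<close>

text \<open>\<open>partial_deriv\<close> differentiates at parameter 0 of a line. Recentring at an
  arbitrary \<open>t\<close> turns it into the derivative along a whole segment, as the mean value
  arguments require.\<close>

lemma has_real_derivative_partial_deriv:
  fixes f :: "real^'p::finite \<Rightarrow> real"
  assumes f: "f differentiable_on U" and U: "open U" "\<theta> + t *\<^sub>R axis i 1 \<in> U"
  shows "((\<lambda>t. f (\<theta> + t *\<^sub>R axis i 1)) has_real_derivative
           partial_deriv i f (\<theta> + t *\<^sub>R axis i 1)) (at t)"
proof -
  have "f differentiable (at (\<theta> + t *\<^sub>R axis i 1))"
    using f U by (simp add: differentiable_on_eq_differentiable_at)
  then have "(\<lambda>s. f ((\<theta> + t *\<^sub>R axis i 1) + s *\<^sub>R axis i 1)) differentiable (at 0)"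
    by (intro differentiable_chain_at[of "\<lambda>s. (\<theta> + t *\<^sub>R axis i 1) + s *\<^sub>R axis i 1" 0 f,
          unfolded o_def]) auto
  then have "((\<lambda>s. f ((\<theta> + t *\<^sub>R axis i 1) + s *\<^sub>R axis i 1)) has_real_derivative
           partial_deriv i f (\<theta> + t *\<^sub>R axis i 1)) (at 0)"
    unfolding partial_deriv_def
    by (metis DERIV_deriv_iff_real_differentiable)
  then show ?thesis
    using DERIV_shift[of "\<lambda>t. f (\<theta> + t *\<^sub>R axis i 1)" _ 0 t]
    by (simp add: algebra_simps)
qed

lemma eventually_line_in_open:
  fixes \<theta> v :: "'v::real_normed_vector"
  assumes "open U" "\<theta> \<in> U"
  shows "\<forall>\<^sub>F t in nhds (0::real). \<theta> + t *\<^sub>R v \<in> U"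
proof -
  have "((\<lambda>t::real. \<theta> + t *\<^sub>R v) \<longlongrightarrow> \<theta> + 0 *\<^sub>R v) (nhds 0)"
    by (intro tendsto_intros filterlim_ident)
  then show ?thesis using assms by (auto dest: topological_tendstoD)
qed

lemma line_segment_in_open:
  fixes \<theta> v :: "'v::real_normed_vector"
  assumes "open U" "\<theta> \<in> U"
  shows "\<exists>r>0. \<forall>t::real. \<bar>t\<bar> < r \<longrightarrow> \<theta> + t *\<^sub>R v \<in> U"
  using eventually_line_in_open[OF assms, of v] unfolding eventually_nhds_metric
  by (auto simp: dist_real_def)

lemma partial_deriv_cong:
  assumes "open U" "\<theta> \<in> U" "\<And>\<theta>'. \<theta>' \<in> U \<Longrightarrow> f \<theta>' = g \<theta>'"
  shows "partial_deriv i f \<theta> = partial_deriv i g \<theta>"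
  unfolding partial_deriv_def
  by (rule deriv_cong_ev[OF eventually_mono[OF eventually_line_in_open[OF assms(1,2)] assms(3)] refl])

text \<open>The outer derivative looks at the inner one near \<theta>, so the functions must agree
  on an open set and not just at \<theta>.\<close>

lemma hessian_cong:
  assumes "open U" "\<theta> \<in> U" "\<And>\<theta>'. \<theta>' \<in> U \<Longrightarrow> f \<theta>' = g \<theta>'"
  shows "hessian f \<theta> = hessian g \<theta>"
  unfolding hessian_def
  by (simp add: vec_eq_iff partial_deriv_cong[OF assms(1,2) partial_deriv_cong[OF assms(1) _ assms(3)]])

text \<open>One function \<open>w\<close> dominates everything: each Hessian entry is bounded by the
  spectral norm, and the first partial derivatives are controlled through the second ones.\<close>

lemma
  fixes F :: "'b \<Rightarrow> real^'p::finite \<Rightarrow> real" and w :: "'b \<Rightarrow> real"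
  assumes U: "open U" "\<theta> \<in> U"
    and int: "\<And>\<theta>'. \<theta>' \<in> U \<Longrightarrow> integrable M (\<lambda>x. F x \<theta>')"
    and smooth: "\<And>x. x \<in> space M \<Longrightarrow> twice_differentiable_on (F x) U"
    and bound: "\<And>\<theta>' x. \<theta>' \<in> U \<Longrightarrow> x \<in> space M \<Longrightarrow> spectral_norm (hessian (F x) \<theta>') \<le> w x"
    and w: "integrable M w"
  shows integrable_hessian: "integrable M (\<lambda>x. hessian (F x) \<theta>)"
    and hessian_integral: "hessian (\<lambda>\<theta>'. \<integral>x. F x \<theta>' \<partial>M) \<theta> = (\<integral>x. hessian (F x) \<theta> \<partial>M)"
proof -
  have D1: "F x differentiable_on U" and D2: "partial_deriv j (F x) differentiable_on U"
    if "x \<in> space M" for x j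
    using smooth[OF that] by (auto simp: twice_differentiable_on_def)
  have entry: "\<bar>partial_deriv i (partial_deriv j (F x)) \<theta>'\<bar> \<le> w x"
    if "\<theta>' \<in> U" "x \<in> space M" for i j \<theta>' x
  proof -
    have "\<bar>hessian (F x) \<theta>' $ i $ j\<bar> \<le> spectral_norm (hessian (F x) \<theta>')"
      unfolding spectral_norm_def by (rule matrix_component_le_onorm)
    with bound[OF that] show ?thesis by (simp add: hessian_def)
  qed
  \<comment> \<open>Proved at every point of \<open>U\<close>, since the second differentiation uses
    the formula on a neighbourhood of \<theta>. The second derivative along the same axis
    \<open>j\<close> is a diagonal Hessian entry.\<close>
  have first: "integrable M (\<lambda>x. partial_deriv j (F x) \<theta>') \<and>
      partial_deriv j (\<lambda>\<theta>'. \<integral>x. F x \<theta>' \<partial>M) \<theta>' = (\<integral>x. partial_deriv j (F x) \<theta>' \<partial>M)"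
    if \<theta>': "\<theta>' \<in> U" for j \<theta>'
  proof -
    obtain r where r: "r > 0" "\<And>t. \<bar>t\<bar> < r \<Longrightarrow> \<theta>' + t *\<^sub>R axis j 1 \<in> U"
      using line_segment_in_open[OF U(1) \<theta>', where v = "axis j 1"] by blast
    note hyps = r(1) int[OF r(2)] has_real_derivative_partial_deriv[OF D1 U(1) r(2)]
      has_real_derivative_partial_deriv[OF D2 U(1) r(2)] entry[OF r(2)] w
    show ?thesis
      using integrable_deriv_second_bounded[OF hyps]
        DERIV_imp_deriv[OF has_real_derivative_integral_second_bounded[OF hyps]]
      by (simp add: partial_deriv_def)
  qed
  \<comment> \<open>No third derivative is at hand, so the Lipschitz version is used; its constant
    \<open>w x\<close> comes from the bound on the mixed second derivative along the segment in
    direction \<open>i\<close>.\<close>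
  have second: "integrable M (\<lambda>x. partial_deriv i (partial_deriv j (F x)) \<theta>) \<and>
      partial_deriv i (partial_deriv j (\<lambda>\<theta>'. \<integral>x. F x \<theta>' \<partial>M)) \<theta>
        = (\<integral>x. partial_deriv i (partial_deriv j (F x)) \<theta> \<partial>M)" for i j
  proof -
    obtain r where r: "r > 0" "\<And>t. \<bar>t\<bar> < r \<Longrightarrow> \<theta> + t *\<^sub>R axis i 1 \<in> U"
      using line_segment_in_open[OF U, where v = "axis i 1"] by blast
    have int': "integrable M (\<lambda>x. partial_deriv j (F x) (\<theta> + t *\<^sub>R axis i 1))" if "\<bar>t\<bar> < r" for t
      using first[OF r(2)[OF that]] by blast
    have d0: "((\<lambda>t. partial_deriv j (F x) (\<theta> + t *\<^sub>R axis i 1)) has_real_derivative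
        partial_deriv i (partial_deriv j (F x)) \<theta>) (at 0)" if "x \<in> space M" for x
      using has_real_derivative_partial_deriv[OF D2[OF that] U(1), of \<theta> 0 i] U(2) by simp
    have bnd: "\<bar>partial_deriv j (F x) (\<theta> + t *\<^sub>R axis i 1) - partial_deriv j (F x) (\<theta> + 0 *\<^sub>R axis i 1)\<bar>
        \<le> w x * \<bar>t\<bar>" if t: "\<bar>t\<bar> < r" and x: "x \<in> space M" for t x
    proof -
      have S: "\<theta> + s *\<^sub>R axis i 1 \<in> U" if "s \<in> {-r<..<r}" for s
        using that by (intro r(2)) auto
      have "norm (partial_deriv j (F x) (\<theta> + t *\<^sub>R axis i 1) - partial_deriv j (F x) (\<theta> + 0 *\<^sub>R axis i 1))
          \<le> w x * norm (t - 0)"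
        using t r(1)
        by (intro field_differentiable_bound[where S = "{-r<..<r}" and
              f' = "\<lambda>t. partial_deriv i (partial_deriv j (F x)) (\<theta> + t *\<^sub>R axis i 1)"])
          (auto intro!: entry S x
            has_field_derivative_at_within[OF has_real_derivative_partial_deriv[OF D2 U(1)]])
      then show ?thesis by simp
    qed
    note hyps = r(1) int' d0 bnd w
    have "partial_deriv i (partial_deriv j (\<lambda>\<theta>'. \<integral>x. F x \<theta>' \<partial>M)) \<theta>
        = partial_deriv i (\<lambda>\<theta>'. \<integral>x. partial_deriv j (F x) \<theta>' \<partial>M) \<theta>"
      using first by (intro partial_deriv_cong[OF U]) blast
    also have "\<dots> = (\<integral>x. partial_deriv i (partial_deriv j (F x)) \<theta> \<partial>M)"
      unfolding partial_deriv_def[of i "\<lambda>\<theta>'. \<integral>x. partial_deriv j (F x) \<theta>' \<partial>M"]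
      by (rule DERIV_imp_deriv[OF has_real_derivative_integral_dominated[OF hyps]])
    finally show ?thesis
      using integrable_deriv_dominated[OF hyps] by blast
  qed
  have row: "integrable M (\<lambda>x. hessian (F x) \<theta> $ i)" for i
    by (rule integrable_vecI) (simp add: hessian_def second)
  then show "integrable M (\<lambda>x. hessian (F x) \<theta>)"
    by (rule integrable_vecI)
  have "(\<integral>x. hessian (F x) \<theta> \<partial>M) $ i $ j = (\<integral>x. partial_deriv i (partial_deriv j (F x)) \<theta> \<partial>M)"
    for i j
  proof -
    have "(\<integral>x. hessian (F x) \<theta> \<partial>M) $ i $ j = (\<integral>x. hessian (F x) \<theta> $ i \<partial>M) $ j"
      by (subst integral_vec_nth[OF row]) simp
    also have "\<dots> = (\<integral>x. hessian (F x) \<theta> $ i $ j \<partial>M)"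
      by (subst integral_vec_nth) (simp_all add: hessian_def second)
    finally show ?thesis by (simp add: hessian_def)
  qed
  then show "hessian (\<lambda>\<theta>'. \<integral>x. F x \<theta>' \<partial>M) \<theta> = (\<integral>x. hessian (F x) \<theta> \<partial>M)"
    by (simp add: vec_eq_iff hessian_def second)
qed

section \<open>Gaussian smoothing\<close>

lemma sets_gaussian [simp, measurable_cong]: "sets (gaussian \<sigma>) = sets borel"
  and space_gaussian [simp]: "space (gaussian \<sigma>) = UNIV"
  by (simp_all add: gaussian_def)

text \<open>The density is a product over the basis, so its integral factors into one-dimensional
  normal integrals, each equal to 1.\<close>

lemma prob_space_gaussian:
  assumes "\<sigma> > 0"
  shows "prob_space (gaussian \<sigma> :: 'x::euclidean_space measure)"
proof
  interpret N: prob_space "density lborel (normal_density 0 \<sigma>)"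
    using assms by (rule prob_space_normal_density)
  have one: "(\<integral>\<^sup>+y. ennreal (normal_density 0 \<sigma> y) \<partial>lborel) = 1"
    using N.emeasure_space_1 by (simp add: emeasure_density)
  have "emeasure (gaussian \<sigma>) (space (gaussian \<sigma> :: 'x measure))
      = (\<integral>\<^sup>+\<delta>. (\<Prod>b\<in>Basis. ennreal (normal_density 0 \<sigma> ((\<delta>::'x) \<bullet> b))) \<partial>lborel)"
    by (simp add: gaussian_def emeasure_density prod_ennreal)
  also have "\<dots> = 1"
    by (subst nn_integral_lborel_prod) (simp_all add: one)
  finally show "emeasure (gaussian \<sigma>) (space (gaussian \<sigma> :: 'x measure)) = 1" .
qed

text \<open>The density is at most \<open>(1 / \<sigma>) ^ DIM('x)\<close>, which \<sigma> \<ge> 1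
  lets one weaken to the dimension-free \<open>1 / \<sigma>\<close>. Translation invariance of
  Lebesgue measure then removes \<open>x\<close>.\<close>

lemma emeasure_gaussian_translate_le:
  fixes S :: "'x::euclidean_space set"
  assumes \<sigma>: "\<sigma> \<ge> 1" and S: "S \<in> sets borel"
  shows "emeasure (gaussian \<sigma>) {\<delta>. x + \<delta> \<in> S} \<le> ennreal (1 / \<sigma>) * emeasure lborel S"
proof -
  have normal_le: "normal_density 0 \<sigma> y \<le> 1 / \<sigma>" for y
  proof -
    have "\<sigma> = sqrt (\<sigma>\<^sup>2)" using \<sigma> by simp
    also have "\<dots> \<le> sqrt (2 * pi * \<sigma>\<^sup>2)"
      using pi_gt3 by (intro real_sqrt_le_mono) (simp add: mult_le_cancel_right1)
    finally have "1 / sqrt (2 * pi * \<sigma>\<^sup>2) \<le> 1 / \<sigma>"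
      using \<sigma> by (intro divide_left_mono) auto
    then have "1 / sqrt (2 * pi * \<sigma>\<^sup>2) * exp (- y\<^sup>2 / (2 * \<sigma>\<^sup>2)) \<le> 1 / \<sigma> * 1"
      using \<sigma> by (intro mult_mono) auto
    then show ?thesis by (simp add: normal_density_def)
  qed
  have dens: "(\<Prod>b\<in>Basis. normal_density 0 \<sigma> (\<delta> \<bullet> b)) \<le> 1 / \<sigma>" for \<delta> :: 'x
  proof -
    have "(\<Prod>b\<in>Basis. normal_density 0 \<sigma> (\<delta> \<bullet> b)) \<le> (\<Prod>b\<in>(Basis::'x set). 1 / \<sigma>)"
      by (intro prod_mono) (auto simp: normal_le)
    also have "\<dots> = (1 / \<sigma>) ^ DIM('x)" by simp
    also have "\<dots> \<le> (1 / \<sigma>) ^ 1"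
      using \<sigma> DIM_positive[where 'a='x] by (intro power_decreasing) auto
    finally show ?thesis by simp
  qed
  note [measurable] = S
  have "emeasure (gaussian \<sigma>) {\<delta>. x + \<delta> \<in> S}
      = (\<integral>\<^sup>+\<delta>. ennreal (\<Prod>b\<in>Basis. normal_density 0 \<sigma> (\<delta> \<bullet> b)) * indicator {\<delta>. x + \<delta> \<in> S} \<delta> \<partial>lborel)"
    unfolding gaussian_def by (subst emeasure_density) (simp_all add: measurable)
  also have "\<dots> \<le> (\<integral>\<^sup>+\<delta>. ennreal (1 / \<sigma>) * indicator S (x + \<delta>) \<partial>lborel)"
    by (intro nn_integral_mono) (auto simp: indicator_def intro!: ennreal_leI dens)
  also have "\<dots> = ennreal (1 / \<sigma>) * (\<integral>\<^sup>+\<delta>. indicator S (x + \<delta>) \<partial>lborel)"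
    by (rule nn_integral_cmult) simp
  also have "(\<integral>\<^sup>+\<delta>. indicator S (x + \<delta>) \<partial>lborel) = (\<integral>\<^sup>+y. indicator S y \<partial>distr lborel borel ((+) x))"
    by (subst nn_integral_distr) simp_all
  also have "\<dots> = emeasure lborel S"
    by (simp add: lborel_distr_plus)
  finally show ?thesis .
qed

lemma gaussian_smoothing_le:
  fixes I :: "'x::euclidean_space \<Rightarrow> real"
  assumes I[measurable]: "I \<in> borel_measurable borel"
    and bounds: "\<And>x. 0 \<le> I x" "\<And>x. I x \<le> m" "0 \<le> a"
    and fin: "emeasure lborel {x. a \<le> I x} = ennreal s" "0 \<le> s"
    and \<sigma>: "\<sigma> \<ge> 1"
  shows "(\<integral>\<delta>. I (x + \<delta>) \<partial>gaussian \<sigma>) \<le> a + m * (s / \<sigma>)"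
proof -
  interpret prob_space "gaussian \<sigma> :: 'x measure"
    using \<sigma> by (intro prob_space_gaussian) simp
  let ?T = "{\<delta>. a \<le> I (x + \<delta>)}"
  have m: "0 \<le> m" using bounds(1,2)[of 0] by linarith
  have [measurable]: "?T \<in> sets borel" by simp
  have "emeasure (gaussian \<sigma>) ?T \<le> ennreal (1 / \<sigma>) * ennreal s"
    using emeasure_gaussian_translate_le[OF \<sigma>, of "{x. a \<le> I x}" x] by (simp add: fin(1))
  then have T: "measure (gaussian \<sigma>) ?T \<le> s / \<sigma>"
    using \<sigma> fin(2) by (simp add: emeasure_eq_measure ennreal_mult[symmetric])
  have int_T: "integrable (gaussian \<sigma>) (indicator ?T :: 'x \<Rightarrow> real)"
    by (intro integrable_real_indicator) (simp_all add: emeasure_eq_measure)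
  have "(\<integral>\<delta>. I (x + \<delta>) \<partial>gaussian \<sigma>) \<le> (\<integral>\<delta>. a + m * indicator ?T \<delta> \<partial>gaussian \<sigma>)"
  proof (rule integral_mono)
    show "integrable (gaussian \<sigma>) (\<lambda>\<delta>. I (x + \<delta>))"
      using bounds by (intro integrable_const_bound[where B = m]) auto
    show "integrable (gaussian \<sigma>) (\<lambda>\<delta>. a + m * indicator ?T \<delta>)"
      by (intro Bochner_Integration.integrable_add integrable_mult_right int_T) simp
    \<comment> \<open>Off \<open>?T\<close> the bound is \<open>a\<close>; on \<open>?T\<close> it
      is \<open>m\<close>, and the extra \<open>a\<close> is harmless because it is
      nonnegative.\<close>
    show "I (x + \<delta>) \<le> a + m * indicator ?T \<delta>" for \<delta>
      using bounds(2)[of "x + \<delta>"] bounds(3) by (auto simp: indicator_def)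
  qed
  also have "\<dots> = a + m * measure (gaussian \<sigma>) ?T"
    using int_T prob_space by simp
  also have "\<dots> \<le> a + m * (s / \<sigma>)"
    using T m by (intro add_left_mono mult_left_mono)
  finally show ?thesis .
qed

section \<open>The perturbed objective as a smoothed objective\<close>

lemma expectation_importance_ratio:
  assumes "set_pmf q \<subseteq> set_pmf p"
  shows "measure_pmf.expectation p (\<lambda>a. pmf q a / pmf p a * h a) =
           (\<integral>a. pmf q a * h a \<partial>count_space UNIV)"
proof -
  have "measure_pmf.expectation p (\<lambda>a. pmf q a / pmf p a * h a) =
      (\<integral>a. pmf p a *\<^sub>R (pmf q a / pmf p a * h a) \<partial>count_space UNIV)"
    unfolding measure_pmf_eq_density by (rule integral_density) auto
  also have "\<dots> = (\<integral>a. pmf q a * h a \<partial>count_space UNIV)"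
    \<comment> \<open>Where \<open>pmf p a = 0\<close> nothing cancels and the left integrand is 0;
      the support inclusion makes \<open>pmf q a\<close> vanish there as well.\<close>
    using assms by (intro Bochner_Integration.integral_cong) (auto simp: pmf_eq_0_set_pmf)
  finally show ?thesis .
qed

text \<open>After cancellation neither side depends on the rollout policy, so perturbing the
  training input alone has the same effect as evaluating \<open>J\<close> at the perturbed
  input.\<close>

lemma expectation_weighted_advantage_eq_J:
  assumes "\<And>x. set_pmf (\<pi> \<theta> y) \<subseteq> set_pmf (\<mu> \<theta>\<^sub>o x)"
  shows "measure_pmf.expectation (\<mu> \<theta>\<^sub>o x) (weighted_advantage \<pi> \<mu> A \<theta>\<^sub>o x y \<theta>) = J \<pi> \<mu> A \<theta>\<^sub>o y \<theta>"
  unfolding J_def weighted_advantage_def by (simp only: expectation_importance_ratio[OF assms])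

theorem theorem4:
  fixes \<pi> \<mu> :: "real^'p::finite \<Rightarrow> 'x::euclidean_space \<Rightarrow> 'a pmf"
    and A :: "'a \<Rightarrow> real"
    and \<theta> \<theta>\<^sub>o :: "real^'p"
    and U :: "(real^'p) set"
    and g :: "'x \<Rightarrow> real"
    and c :: real
  assumes nbhd: "open U" "\<theta> \<in> U"
    and support: "\<And>\<theta>' x y. \<theta>' \<in> U \<Longrightarrow> set_pmf (\<pi> \<theta>' y) \<subseteq> set_pmf (\<mu> \<theta>\<^sub>o x)"
    and measurable: "\<And>\<theta>' a. \<theta>' \<in> U \<Longrightarrow> (\<lambda>x. pmf (\<pi> \<theta>' x) a) \<in> borel_measurable borel"
    and J_defined: "\<And>\<theta>' x. \<theta>' \<in> U \<Longrightarrow>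
          integrable (measure_pmf (\<mu> \<theta>\<^sub>o x)) (weighted_advantage \<pi> \<mu> A \<theta>\<^sub>o x x \<theta>')"
    and J_ALP_defined: "\<And>\<theta>' \<sigma> x. \<theta>' \<in> U \<Longrightarrow> \<sigma> > 0 \<Longrightarrow>
          integrable (gaussian \<sigma>) (\<lambda>\<delta>. measure_pmf.expectation (\<mu> \<theta>\<^sub>o x)
            (weighted_advantage \<pi> \<mu> A \<theta>\<^sub>o x (x + \<delta>) \<theta>'))"
    and smooth: "\<And>x. twice_differentiable_on (J \<pi> \<mu> A \<theta>\<^sub>o x) U"
    and dominated: "\<And>\<theta>' x. \<theta>' \<in> U \<Longrightarrow> curvature \<pi> \<mu> A \<theta>\<^sub>o x \<theta>' \<le> g x"
    and dominating: "\<And>\<sigma> x. \<sigma> > 0 \<Longrightarrow> integrable (gaussian \<sigma>) (\<lambda>\<delta>. g (x + \<delta>))"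
    and c_range: "0 < c" "c < 1"
    and c_finite: "finite_high_curvature (\<lambda>x. curvature \<pi> \<mu> A \<theta>\<^sub>o x \<theta>) c"
    and c_smallest: "\<And>c'. 0 < c' \<Longrightarrow> c' < 1 \<Longrightarrow>
          finite_high_curvature (\<lambda>x. curvature \<pi> \<mu> A \<theta>\<^sub>o x \<theta>) c' \<Longrightarrow> c \<le> c'"
  shows "\<exists>\<sigma>>0. (SUP x. ereal (curvature_ALP \<pi> \<mu> A \<theta>\<^sub>o \<sigma> x \<theta>))
                 \<le> ereal c * (SUP x. ereal (curvature \<pi> \<mu> A \<theta>\<^sub>o x \<theta>))"
proof -
  let ?F = "\<lambda>x \<delta>. J \<pi> \<mu> A \<theta>\<^sub>o (x + \<delta>)"
  let ?I = "\<lambda>x. curvature \<pi> \<mu> A \<theta>\<^sub>o x \<theta>"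
  let ?H = "\<lambda>x. hessian (J \<pi> \<mu> A \<theta>\<^sub>o x) \<theta>"
  have shift: "measure_pmf.expectation (\<mu> \<theta>\<^sub>o x) (weighted_advantage \<pi> \<mu> A \<theta>\<^sub>o x y \<theta>') = J \<pi> \<mu> A \<theta>\<^sub>o y \<theta>'"
    if "\<theta>' \<in> U" for x y \<theta>'
    using support[OF that] by (rule expectation_weighted_advantage_eq_J)
  have int: "integrable (gaussian \<sigma>) (\<lambda>\<delta>. ?F x \<delta> \<theta>')" if "\<sigma> > 0" "\<theta>' \<in> U" for \<sigma> x \<theta>'
    using J_ALP_defined[OF that(2,1), of x] by (simp add: shift[OF that(2)])
  have bound: "spectral_norm (hessian (?F x \<delta>) \<theta>') \<le> g (x + \<delta>)" if "\<theta>' \<in> U" for x \<delta> \<theta>'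
    using dominated[OF that] by (simp add: curvature_def)
  have int_H: "integrable (gaussian \<sigma>) (\<lambda>\<delta>. ?H (x + \<delta>))" if "\<sigma> > 0" for \<sigma> x
    using that by (intro integrable_hessian[OF nbhd int smooth bound dominating])
  have H_ALP: "hessian (J_ALP \<pi> \<mu> A \<theta>\<^sub>o \<sigma> x) \<theta> = (\<integral>\<delta>. ?H (x + \<delta>) \<partial>gaussian \<sigma>)" if "\<sigma> > 0" for \<sigma> x
  proof -
    have "hessian (J_ALP \<pi> \<mu> A \<theta>\<^sub>o \<sigma> x) \<theta> = hessian (\<lambda>\<theta>'. \<integral>\<delta>. ?F x \<delta> \<theta>' \<partial>gaussian \<sigma>) \<theta>"
      by (rule hessian_cong[OF nbhd]) (simp add: J_ALP_def shift)
    also have "\<dots> = (\<integral>\<delta>. ?H (x + \<delta>) \<partial>gaussian \<sigma>)"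
      using that by (intro hessian_integral[OF nbhd int smooth bound dominating])
    finally show ?thesis .
  qed
  \<comment> \<open>Integrability of the shifted Hessian, taken at \<sigma> = 1 and shift 0,
    contains its Borel measurability.\<close>
  have meas_H: "?H \<in> borel_measurable borel"
    using borel_measurable_integrable[OF int_H[of 1 0]] by simp
  then have meas_I [measurable]: "?I \<in> borel_measurable borel"
    unfolding curvature_def by (rule measurable_compose) measurable
  have I_nonneg: "0 \<le> ?I x" for x
    by (simp add: curvature_def spectral_norm_nonneg)
  show ?thesis
  proof (cases "(SUP x. ereal (?I x)) = \<infinity>")
    case True
    \<comment> \<open>Since \<open>c > 0\<close>, the right-hand side is infinite and any positive
      \<sigma> would do.\<close>
    then show ?thesis using c_range by (intro exI[of _ 1]) simp
  next
    case False
    have "0 \<le> (SUP x. ereal (?I x))"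
      using I_nonneg by (intro SUP_upper2[of undefined]) auto
    with False obtain m where m: "(SUP x. ereal (?I x)) = ereal m" "0 \<le> m"
      by (cases "SUP x. ereal (?I x)") auto
    have I_le: "?I x \<le> m" for x
      using SUP_upper[of x UNIV "\<lambda>x. ereal (?I x)"] by (simp add: m)
    \<comment> \<open>With a finite supremum the threshold is a real number; measurability of this
      set then identifies the integral of its indicator with its Lebesgue measure.\<close>
    have "{x. ereal (c / 2) * ereal m \<le> ereal (?I x)} = {x. c / 2 * m \<le> ?I x}" by simp
    moreover have "{x. c / 2 * m \<le> ?I x} \<in> sets lborel" by simp
    ultimately have "emeasure lborel {x. c / 2 * m \<le> ?I x} < \<infinity>"
      using c_finite unfolding finite_high_curvature_def m by simp
    then obtain s where s: "emeasure lborel {x. c / 2 * m \<le> ?I x} = ennreal s" "0 \<le> s"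
      by (cases "emeasure lborel {x. c / 2 * m \<le> ?I x}") auto
    define \<sigma> where "\<sigma> = max 1 (2 * s / c)"
    have \<sigma>: "\<sigma> \<ge> 1" "2 * s / c \<le> \<sigma>" by (auto simp: \<sigma>_def)
    have s_le: "s / \<sigma> \<le> c / 2"
      using \<sigma> c_range by (simp add: field_simps)
    have "curvature_ALP \<pi> \<mu> A \<theta>\<^sub>o \<sigma> x \<theta> \<le> c * m" for x
    proof -
      interpret prob_space "gaussian \<sigma> :: 'x measure"
        using \<sigma> by (intro prob_space_gaussian) simp
      have "integrable (gaussian \<sigma>) (\<lambda>\<delta>. ?I (x + \<delta>))"
        using I_nonneg I_le by (intro integrable_const_bound[where B = m]) auto
      then have "curvature_ALP \<pi> \<mu> A \<theta>\<^sub>o \<sigma> x \<theta> \<le> (\<integral>\<delta>. ?I (x + \<delta>) \<partial>gaussian \<sigma>)"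
        using \<sigma> spectral_norm_integral_le[OF int_H] by (simp add: curvature_ALP_def H_ALP curvature_def)
      also have "\<dots> \<le> c / 2 * m + m * (s / \<sigma>)"
        using c_range m by (intro gaussian_smoothing_le meas_I I_nonneg I_le s \<sigma>) simp
      also have "\<dots> \<le> c / 2 * m + m * (c / 2)"
        using s_le m by (intro add_left_mono mult_left_mono)
      finally show ?thesis by simp
    qed
    then have "(SUP x. ereal (curvature_ALP \<pi> \<mu> A \<theta>\<^sub>o \<sigma> x \<theta>)) \<le> ereal c * (SUP x. ereal (?I x))"
      unfolding m by (intro SUP_least) simp
    then show ?thesis using \<sigma> by (intro exI[of _ \<sigma>]) simp
  qed
qed

end
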